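(* For all integers $n\ge 0$, $$T_n(x,s,q)=\frac{q^{n(n+1)}}{[1][3]\cdots[2n-1]}\;\frac{1}{h\!\left(-\frac{x^2}{s}\right)}\;D^n\!\left(h\!\left(-\frac{x^2}{q^{2n}s}\right)\prod_{k=1}^n\left(\frac{x^2}{q^{2k+1}}+\frac sq\right)\right)$$ and $$U_n(x,s,q)=\frac{[n+1]}{[3][5]\cdots[2n+1]}\;h\!\left(-\frac{qx^2}{s}\right)\;D^n\!\left(\frac{1}{h\!\left(-\frac{x^2}{q^{2n-1}s}\right)}\prod_{k=1}^n\left(\frac{x^2}{q^{2k-1}}+\frac sq\right)\right).$$
   Context: Here $x,s,q$ are indeterminates, and the identities are understood as identities of formal power series in $x$ with coefficients in the field of rational functions in $s,q$ (empty products equal $1$). $D$ is the $q$-differentiation operator with respect to $x$, $Df(x)=\frac{f(x)-f(qx)}{x-qx}$. Notation: $(a;q)_n=\prod_{j=0}^{n-1}(1-q^ja)$; $\begin{bmatrix} n\\k\end{bmatrix}=\frac{(q;q)_n}{(q;q)_k(q;q)_{n-k}}$ for $0\le k\le n$; $[n]=\frac{1-q^n}{1-q}$. The series $h$ is $$h(x)=\sum_{k\ge 0}\frac{(q;q^2)_k}{(q^2;q^2)_k}\,x^k=\frac{(qx;q^2)_\infty}{(x;q^2)_\infty},$$ where $(a;q)_\infty=\prod_{j\ge0}(1-q^ja)$. The $q$-Chebyshev polynomials of the second kind are, for $n\ge0$, $$U_n(x,s,q)=\sum_{k=0}^{\lfloor n/2\rfloor}q^{k^2}\begin{bmatrix}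 n-k\\k\end{bmatrix}(1+q^{k+1})\cdots(1+q^{n-k})\,s^kx^{n-2k}.$$ The $q$-Chebyshev polynomials of the first kind are $T_0(x,s,q)=1$ and, for $n>0$, $$T_n(x,s,q)=\sum_{k=0}^{\lfloor n/2\rfloor}q^{k^2}\frac{[n]}{[n-k]}\begin{bmatrix} n-k\\k\end{bmatrix}\frac{(-q;q)_{n-1}}{(-q;q)_k\,(-q^{n-k};q)_k}\,s^kx^{n-2k}.$$
   Formalization: The formula for U_n is proved with the additional factor q^{n(n+1)} on its right-hand side; as printed it fails for n≥1 (at n=1 the right-hand side is (1+q)x/q^2, whereas U_1=(1+q)x). *)

theory Defs
  imports "HOL-Computational_Algebra.Computational_Algebra"
begin

text \<open>
  The coefficient field of rational functions in the indeterminates \<open>s\<close>, \<open>q\<close> over a field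
  \<open>'k\<close> of characteristic zero is the fraction field of \<open>'k[q][s]\<close>: the inner polynomial
  variable is \<open>q\<close>, the outer one is \<open>s\<close>. The indeterminate \<open>x\<close> is the variable of
  the polynomials and formal power series over this field. The \<open>q\<close>-notions themselves are defined
  over an arbitrary field.
\<close>

definition indet_q :: "'k::field_char_0 poly poly fract" where
  "indet_q = Fract [:[:0, 1:]:] 1"

definition indet_s :: "'k::field_char_0 poly poly fract" where
  "indet_s = Fract [:0, 1:] 1"

definition qpoch :: "'a::field \<Rightarrow> 'a \<Rightarrow> nat \<Rightarrow> 'a" where
  "qpoch a q n = (\<Prod>j<n. 1 - q ^ j * a)"

definition qnum :: "'a::field \<Rightarrow> nat \<Rightarrow> 'a" where
  "qnum q n = (1 - q ^ n) / (1 - q)"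

text \<open>Only used for \<open>k \<le> n\<close>, so that the natural subtraction is harmless.\<close>

definition qbinom :: "'a::field \<Rightarrow> nat \<Rightarrow> nat \<Rightarrow> 'a" where
  "qbinom q n k = qpoch q q n / (qpoch q q k * qpoch q q (n - k))"

text \<open>
  The composition is \<open>f(q x)\<close>. The division is that of formal power series; it is exact for
  \<open>q \<noteq> 1\<close>, as the numerator has no constant term.
\<close>

definition qdiff :: "'a::field \<Rightarrow> 'a fps \<Rightarrow> 'a fps" where
  "qdiff q f = (f - fps_compose f (fps_const q * fps_X)) / (fps_X - fps_const q * fps_X)"

definition hser :: "'a::field \<Rightarrow> 'a fps" where
  "hser q = Abs_fps (\<lambda>k. qpoch q (q ^ 2) k / qpoch (q ^ 2) (q ^ 2) k)"

definition hsub :: "'a::field \<Rightarrow> 'a \<Rightarrow> 'a fps" \<comment> \<open>\<open>h(c x\<^sup>2)\<close>\<close> where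
  "hsub q c = fps_compose (hser q) (fps_const c * fps_X ^ 2)"

text \<open>The Chebyshev polynomials are polynomials in \<open>x\<close>.\<close>

definition qcheb_U :: "nat \<Rightarrow> 'a::field \<Rightarrow> 'a \<Rightarrow> 'a poly" where
  "qcheb_U n s q =
     (\<Sum>k = 0..n div 2.
        monom (q ^ (k ^ 2) * qbinom q (n - k) k * (\<Prod>j = k + 1..n - k. 1 + q ^ j) * s ^ k)
          (n - 2 * k))"

definition qcheb_T :: "nat \<Rightarrow> 'a::field \<Rightarrow> 'a \<Rightarrow> 'a poly" where
  "qcheb_T n s q =
     (if n = 0 then 1
      else (\<Sum>k = 0..n div 2.
        monom (q ^ (k ^ 2) * (qnum q n / qnum q (n - k)) * qbinom q (n - k) k
            * (qpoch (- q) q (n - 1) / (qpoch (- q) q k * qpoch (- (q ^ (n - k))) q k)) * s ^ k)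
          (n - 2 * k)))"

text \<open>
  The source prints the Rodrigues formula for the second kind,
  \<open>U\<^sub>n = [n+1]/([3][5]\<dots>[2n+1]) h(-q x\<^sup>2/s) D\<^sup>n(\<dots>)\<close>, without the factor
  \<open>q\<^bsup>n(n+1)\<^esup>\<close> that its formula for the first kind carries. That is a misprint: for
  \<open>n = 1\<close> the printed right-hand side is \<open>(1+q) x / q\<^sup>2\<close>, whereas \<open>U\<^sub>1 = (1+q) x\<close>.
  The factor has to be restored.
\<close>

end

theory Submission
  imports Defs
begin

text \<open>
  Put \<open>c = -1/s\<close>. By the functional equation \<open>(1 - x) h(x) = (1 - q x) h(q\<^sup>2 x)\<close>, the series to which
  \<open>D\<^sup>n\<close> is applied is in both formulas \<open>(s/q)\<^sup>n W(x) P\<^sub>n(x)\<close> with the same kernel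
  \<open>P\<^sub>n(x) = (1 - q c x\<^sup>2/q\<^sup>2) \<dots> (1 - q c x\<^sup>2/q\<^bsup>2n\<^esup>)\<close>; the weight \<open>W(x)\<close> is \<open>h(c x\<^sup>2)\<close> for the first
  kind and \<open>1/h(q c x\<^sup>2)\<close> for the second, the inverse of the prefactor (\<open>hsub_mult_kernel\<close>,
  \<open>inverse_hsub_mult_kernel\<close>).
  
  Both weights satisfy \<open>(1 - q c x\<^sup>2) W(q x) = (1 - b c x\<^sup>2) W(x)\<close>, with \<open>b = 1\<close> and \<open>b = q\<^sup>2\<close>
  respectively, and \<open>P\<^sub>j(q x) = (1 - q c x\<^sup>2) P\<^bsub>j-1\<^esub>(x)\<close>. So \<open>D(W P\<^sub>j G) = W P\<^bsub>j-1\<^esub> G'\<close>, where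
  \<open>G'(x) = ((1 - q c x\<^sup>2/q\<^bsup>2j\<^esup>) G(x) - (1 - b c x\<^sup>2) G(q x)) / ((1 - q) x)\<close> is again a polynomial when
  \<open>G\<close> is one, of degree at most one higher. After \<open>n\<close> steps from \<open>G = 1\<close> the kernel is used up and the prefactor
  cancels the weight, which leaves a polynomial of degree \<open>n\<close>.
  
  The coefficients of these polynomials obey a recurrence with two terms that has an explicit solution
  \<open>rodrigues_coeff\<close> as a quotient of finite q-products; \<open>b\<close> and \<open>n\<close> enter it only through \<open>b c\<close> and
  \<open>z = 1 / (b q\<^bsup>2n\<^esup>)\<close>, so a single computation serves both kinds (\<open>qdiff_power_weight_kernel\<close>). It remains to
  turn the products of factors \<open>1 - q\<^bsup>-a\<^esup>\<close> around (\<open>rodrigues_coeff_eval\<close>) and to recognise the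
  coefficients of \<open>T\<^sub>n\<close> and \<open>U\<^sub>n\<close> (\<open>qcheb_T_coeff\<close>, \<open>qcheb_U_coeff\<close>). The identities hold over any
  field in which \<open>q \<noteq> 0\<close> is not a root of unity and \<open>s \<noteq> 0\<close>, in particular for indeterminates.
\<close>

section \<open>Finite q-products\<close>

lemma qpoch_0 [simp]: "qpoch a q 0 = 1"
  by (simp add: qpoch_def)

lemma qpoch_Suc: "qpoch a q (Suc n) = qpoch a q n * (1 - q ^ n * a)"
  by (simp add: qpoch_def)

lemma qpoch_self_nonzero:
  fixes q :: "'a::field"
  assumes "\<And>j. j > 0 \<Longrightarrow> q ^ j \<noteq> 1"
  shows "qpoch q q n \<noteq> 0"
proof -
  have "1 - q ^ j * q \<noteq> 0" for j
    using assms[of "Suc j"] by (simp add: mult.commute)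
  then show ?thesis by (simp add: qpoch_def)
qed

lemma power_square_neq_one:
  fixes q :: "'a::field"
  assumes "\<And>j. j > 0 \<Longrightarrow> q ^ j \<noteq> 1" and "j > 0"
  shows "(q\<^sup>2) ^ j \<noteq> 1"
  using assms(1)[of "2 * j"] assms(2) by (simp add: power_mult)

lemma qpoch_square: "qpoch (q\<^sup>2) (q\<^sup>2) n = qpoch q q n * qpoch (- q) q n"
  for q :: "'a::field"
  by (induction n) (auto simp: qpoch_Suc algebra_simps power2_eq_square power_mult_distrib)

text \<open>
  The odd-indexed factors of \<open>(q;q)\<^bsub>2N+1\<^esub>\<close> are \<open>1 - q, 1 - q\<^sup>3, \<dots>\<close>: this is where the
  normalising product \<open>[1][3]\<dots>\<close> of the Rodrigues formulas comes from.
\<close>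

lemma qpoch_odd:
  fixes q :: "'a::field"
  assumes "q \<noteq> 1"
  shows "qpoch q q (2 * N + 1) = qpoch (q\<^sup>2) (q\<^sup>2) N * ((1 - q) ^ Suc N * (\<Prod>k = 1..Suc N. qnum q (2 * k - 1)))"
proof (induction N)
  case 0
  show ?case using assms by (simp add: qpoch_Suc qnum_def)
next
  case (Suc N)
  define Q where "Q = (1 - q) ^ Suc N * (\<Prod>k = 1..Suc N. qnum q (2 * k - 1))"
  have Q: "(1 - q) ^ Suc (Suc N) * (\<Prod>k = 1..Suc (Suc N). qnum q (2 * k - 1)) = Q * (1 - q ^ (2 * N + 3))"
    using assms unfolding Q_def by (simp add: qnum_def eval_nat_numeral)
  have IH: "qpoch q q (2 * N + 1) = qpoch (q\<^sup>2) (q\<^sup>2) N * Q"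
    using Suc.IH unfolding Q_def .
  have sq: "q ^ (2 * N + 2) = (q\<^sup>2) ^ N * q\<^sup>2"
    by (simp only: power_add power_mult)
  have "qpoch q q (2 * Suc N + 1) = qpoch q q (2 * N + 1) * (1 - q ^ (2 * N + 2)) * (1 - q ^ (2 * N + 3))"
    by (simp add: qpoch_Suc eval_nat_numeral mult_ac)
  also have "\<dots> = qpoch (q\<^sup>2) (q\<^sup>2) (Suc N) * (Q * (1 - q ^ (2 * N + 3)))"
    unfolding IH sq qpoch_Suc by (simp only: mult_ac)
  finally show ?case unfolding Q .
qed

text \<open>
  Every factor with a negative exponent is turned around by \<open>1 - p\<^bsup>-a\<^esup> = - p\<^bsup>-a\<^esup> (1 - p\<^sup>a)\<close>. The
  factor \<open>(p;p)\<^bsub>N-1-m\<^esub>\<close> is there to complete the remaining product to \<open>(p;p)\<^bsub>N-1\<^esub>\<close>.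
\<close>

lemma qpoch_reverse:
  fixes p :: "'a::field"
  assumes "p \<noteq> 0" and "m < N"
  shows "qpoch (p / p ^ N) p m * p ^ (\<Sum>i<m. N - 1 - i) * qpoch p p (N - 1 - m) = (- 1) ^ m * qpoch p p (N - 1)"
  using assms(2)
proof (induction m)
  case 0
  show ?case by simp
next
  case (Suc m)
  define r where "r = N - 1 - Suc m"
  have r: "N - 1 - m = Suc r" "N - 1 - Suc m = r" "N = m + r + 2"
    using Suc.prems unfolding r_def by auto
  have flip: "(1 - p ^ m * (p / p ^ N)) * p ^ Suc r = - (1 - p ^ r * p)"
    using assms(1) unfolding r(3) by (simp add: field_simps power_add power2_eq_square)
  have "qpoch (p / p ^ N) p (Suc m) * p ^ (\<Sum>i<Suc m. N - 1 - i) * qpoch p p (N - 1 - Suc m)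
      = qpoch (p / p ^ N) p m * p ^ (\<Sum>i<m. N - 1 - i) * qpoch p p r * ((1 - p ^ m * (p / p ^ N)) * p ^ Suc r)"
    by (simp only: qpoch_Suc sum.lessThan_Suc power_add r(1,2) mult_ac)
  also have "\<dots> = - (qpoch (p / p ^ N) p m * p ^ (\<Sum>i<m. N - 1 - i) * qpoch p p (Suc r))"
    unfolding flip qpoch_Suc by (simp only: mult_ac mult_minus_left mult_minus_right)
  also have "\<dots> = (- 1) ^ Suc m * qpoch p p (N - 1)"
    using Suc.IH[OF Suc_lessD[OF Suc.prems]] by (simp only: r(1) power_Suc mult_1_left mult_minus_left)
  finally show ?case .
qed

section \<open>The coefficients and their recurrence\<close>

text \<open>
  The coefficient of \<open>x\<^sup>i\<close> in the polynomial that is left after \<open>m = i + 2 k\<close> q-differentiations. It is a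
  q-analogue of the coefficient of \<open>x\<^sup>i\<close> in a Gegenbauer polynomial of degree \<open>m\<close>, whose index
  \<open>\<lambda>\<close> corresponds to \<open>z q\<^bsup>2m\<^esup> = q\<^bsup>-2\<lambda>\<^esup>\<close>. In this form nothing becomes singular at \<open>\<lambda> = 0\<close>,
  the value that yields the polynomials of the first kind.
\<close>

definition rodrigues_coeff :: "'a::field \<Rightarrow> 'a \<Rightarrow> 'a \<Rightarrow> nat \<Rightarrow> nat \<Rightarrow> 'a" where
  "rodrigues_coeff q c z i k =
     c ^ (i + k) * q ^ (i choose 2) * qpoch (z * q) q (i + 2 * k) * qpoch q q (i + 2 * k)
     / ((1 - q) ^ (i + 2 * k) * qpoch (z * q\<^sup>2) (q\<^sup>2) k * qpoch (q\<^sup>2) (q\<^sup>2) k * qpoch q q i)"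

text \<open>
  The next three lemmas are one recurrence, with a term missing at each end of the range of \<open>i\<close>. It
  expresses that \<open>x\<^sup>i\<close> arises from \<open>x\<^bsup>i-1\<^esup>\<close> and \<open>x\<^bsup>i+1\<^esup>\<close> under one step of the operator
  \<open>G \<mapsto> ((1 - c z q\<^bsup>2m+1\<^esup> x\<^sup>2) G(x) - (1 - c x\<^sup>2) G(q x)) / ((1 - q) x)\<close>.
\<close>

lemma rodrigues_coeff_top:
  fixes q :: "'a::field"
  assumes nr: "\<And>j. j > 0 \<Longrightarrow> q ^ j \<noteq> 1"
  shows "(1 - q) * rodrigues_coeff q c z (Suc i) 0 =
           c * (q ^ i - z * q ^ (2 * i + 1)) * rodrigues_coeff q c z i 0"
proof -
  have "1 - q \<noteq> 0" using nr[of 1] by simp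
  moreover have "1 - q ^ i * q \<noteq> 0" using nr[of "Suc i"] by (simp add: mult.commute)
  moreover have "Suc i choose 2 = (i choose 2) + i" by (simp add: eval_nat_numeral)
  ultimately show ?thesis
    using qpoch_self_nonzero[OF nr, of i]
    by (simp add: rodrigues_coeff_def qpoch_Suc power_add divide_simps)
       (simp add: algebra_simps power_mult power2_eq_square)
qed

lemma rodrigues_coeff_bottom:
  fixes q :: "'a::field"
  assumes nr: "\<And>j. j > 0 \<Longrightarrow> q ^ j \<noteq> 1"
    and Z: "qpoch (z * q\<^sup>2) (q\<^sup>2) (Suc k) \<noteq> 0"
  shows "rodrigues_coeff q c z 0 (Suc k) = rodrigues_coeff q c z 1 k"
proof -
  have nz: "1 - q \<noteq> 0" "1 - (q\<^sup>2) ^ k * q\<^sup>2 \<noteq> 0"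
    using nr[of 1] power_square_neq_one[OF nr, of "Suc k"] by (auto simp: mult.commute)
  have Z': "qpoch (z * q\<^sup>2) (q\<^sup>2) k \<noteq> 0" "1 - (q\<^sup>2) ^ k * (z * q\<^sup>2) \<noteq> 0"
    using Z by (auto simp: qpoch_Suc)
  have E: "qpoch (q\<^sup>2) (q\<^sup>2) k \<noteq> 0"
    by (rule qpoch_self_nonzero) (rule power_square_neq_one[OF nr])
  define A where "A = qpoch (z * q) q (Suc (2 * k))"
  define B where "B = qpoch q q (Suc (2 * k))"
  have A: "qpoch (z * q) q (2 * Suc k) = A * (1 - (q\<^sup>2) ^ k * (z * q\<^sup>2))"
    unfolding A_def by (simp add: qpoch_Suc power_mult_distrib power_mult power2_eq_square mult_ac)
  have B: "qpoch q q (2 * Suc k) = B * (1 - (q\<^sup>2) ^ k * q\<^sup>2)"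
    unfolding B_def by (simp add: qpoch_Suc power_mult_distrib power_mult power2_eq_square mult_ac)
  show ?thesis
    unfolding rodrigues_coeff_def add_0 A B qpoch_Suc[of _ _ k]
    using nz Z' E
    by (simp add: A_def[symmetric] B_def[symmetric] qpoch_Suc[of _ _ 0] divide_simps
        binomial_eq_0)
qed

text \<open>
  The three terms are rational multiples of a common quantity \<open>B\<close>, so that the recurrence reduces to a
  polynomial identity in \<open>p = q\<^sup>i\<close> and \<open>K = q\<^bsup>2k+2\<^esup>\<close>.
\<close>

lemma rodrigues_coeff_inner:
  fixes q :: "'a::field"
  assumes nr: "\<And>j. j > 0 \<Longrightarrow> q ^ j \<noteq> 1"
    and Z: "qpoch (z * q\<^sup>2) (q\<^sup>2) (Suc k) \<noteq> 0"
  shows "(1 - q) * rodrigues_coeff q c z (Suc i) (Suc k) =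
           c * (q ^ i - z * q ^ (2 * (i + 2 * k + 2) + 1)) * rodrigues_coeff q c z i (Suc k)
           + (1 - q ^ (i + 2)) * rodrigues_coeff q c z (i + 2) k"
proof -
  define K where "K = (q\<^sup>2) ^ k * q\<^sup>2"
  define p where "p = q ^ i"
  have nz: "1 - q \<noteq> 0" "1 - K \<noteq> 0" "1 - q * p \<noteq> 0" "1 - q\<^sup>2 * p \<noteq> 0"
    using nr[of 1] power_square_neq_one[OF nr, of "Suc k"] nr[of "Suc i"] nr[of "Suc (Suc i)"]
    by (auto simp: K_def p_def power2_eq_square mult_ac)
  have Z': "qpoch (z * q\<^sup>2) (q\<^sup>2) k \<noteq> 0" "1 - z * K \<noteq> 0"
    using Z by (auto simp: qpoch_Suc K_def mult_ac)
  have E: "qpoch (q\<^sup>2) (q\<^sup>2) k \<noteq> 0"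
    by (rule qpoch_self_nonzero) (rule power_square_neq_one[OF nr])
  have F: "qpoch q q i \<noteq> 0"
    by (rule qpoch_self_nonzero[OF nr])
  define m where "m = i + 2 * k + 2"
  define B where "B = c ^ (i + k + 1) * q ^ (i choose 2) * qpoch (z * q) q m * qpoch q q m
     / ((1 - q) ^ m * qpoch (z * q\<^sup>2) (q\<^sup>2) k * (1 - z * K) * qpoch (q\<^sup>2) (q\<^sup>2) k * (1 - K)
         * qpoch q q i * (1 - q * p))"
  have qm: "q ^ m = p * K"
    by (simp only: m_def p_def K_def power_add power_mult mult.assoc)
  have c1: "Suc i choose 2 = (i choose 2) + i" by (simp add: eval_nat_numeral)
  have c2: "(i + 2) choose 2 = (i choose 2) + (2 * i + 1)" by (simp add: eval_nat_numeral)
  have m1: "Suc i + 2 * Suc k = Suc m" "i + 2 * Suc k = m" "i + 2 + 2 * k = m"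
    by (auto simp: m_def)
  have Y: "qpoch (z * q\<^sup>2) (q\<^sup>2) (Suc k) = qpoch (z * q\<^sup>2) (q\<^sup>2) k * (1 - z * K)"
    by (simp add: qpoch_Suc K_def mult_ac)
  have E': "qpoch (q\<^sup>2) (q\<^sup>2) (Suc k) = qpoch (q\<^sup>2) (q\<^sup>2) k * (1 - K)"
    by (simp add: qpoch_Suc K_def mult_ac)
  have F1: "qpoch q q (Suc i) = qpoch q q i * (1 - q * p)"
    by (simp add: qpoch_Suc p_def mult_ac)
  have F2: "qpoch q q (i + 2) = qpoch q q i * (1 - q * p) * (1 - q\<^sup>2 * p)"
    by (simp add: qpoch_Suc p_def power2_eq_square mult_ac eval_nat_numeral)
  have t0: "(1 - q) * rodrigues_coeff q c z (Suc i) (Suc k)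
          = B * (c * p * (1 - z * q * (p * K)) * (1 - q * (p * K)))"
    unfolding rodrigues_coeff_def m1 c1 Y E' F1 B_def qpoch_Suc[of _ _ m] qm
    using nz Z' E F by (simp add: divide_simps power_add p_def[symmetric]) (simp add: mult_ac)
  have t1: "rodrigues_coeff q c z i (Suc k) = B * (1 - q * p)"
    unfolding rodrigues_coeff_def m1 Y E' B_def
    using nz Z' E F by (simp add: divide_simps power_add)
  have t2: "(1 - q ^ (i + 2)) * rodrigues_coeff q c z (i + 2) k
          = B * (c * p * p * q * (1 - z * K) * (1 - K))"
  proof -
    have c3: "c ^ (i + 2 + k) = c ^ (i + k + 1) * c" by simp
    have q3: "q ^ ((i choose 2) + (2 * i + 1)) = q ^ (i choose 2) * (p * p * q)"
      by (simp add: power_add p_def mult_2)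
    have q4: "q ^ (i + 2) = q\<^sup>2 * p"
      by (simp add: power_add p_def power2_eq_square)
    show ?thesis
      unfolding rodrigues_coeff_def m1 c2 F2 B_def c3 q3 q4
      using nz Z' E F by (simp add: divide_simps)
  qed
  have key: "c * p * (1 - z * q * (p * K)) * (1 - q * (p * K))
      = c * (p - z * (p * K * (p * K) * q)) * (1 - q * p) + c * p * p * q * (1 - z * K) * (1 - K)"
    by (simp add: algebra_simps)
  have pw: "q ^ (2 * (i + 2 * k + 2) + 1) = p * K * (p * K) * q"
    unfolding m_def[symmetric] qm[symmetric] by (simp add: power_add power_mult power2_eq_square power_mult_distrib)
  show ?thesis
    unfolding t0 t1 t2 pw p_def[symmetric] key by (simp only: distrib_left mult_ac)
qed

section \<open>Iterated q-differentiation\<close>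

lemma nth_one_minus_square_mult:
  fixes G :: "'a::comm_ring_1 fps"
  shows "((1 - fps_const e * fps_X\<^sup>2) * G) $ j = G $ j - (if j < 2 then 0 else e * G $ (j - 2))"
  by (simp add: left_diff_distrib mult.assoc fps_X_power_mult_nth)

definition rodrigues_poly :: "'a::field \<Rightarrow> 'a \<Rightarrow> 'a \<Rightarrow> nat \<Rightarrow> 'a fps" where
  "rodrigues_poly q c z m =
     Abs_fps (\<lambda>j. if j \<le> m \<and> even (m - j) then rodrigues_coeff q c z j ((m - j) div 2) else 0)"

lemma rodrigues_poly_nth:
  "rodrigues_poly q c z (i + 2 * k) $ i = rodrigues_coeff q c z i k"
  by (simp add: rodrigues_poly_def)

lemma rodrigues_poly_nth_eq_0:
  assumes "\<And>k. m \<noteq> j + 2 * k"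
  shows "rodrigues_poly q c z m $ j = 0"
proof -
  have "\<not> (j \<le> m \<and> even (m - j))"
  proof
    assume "j \<le> m \<and> even (m - j)"
    then obtain k where "m - j = 2 * k" "j \<le> m" by blast
    then show False using assms[of k] by simp
  qed
  then show ?thesis by (auto simp add: rodrigues_poly_def)
qed

lemma rodrigues_poly_0: "rodrigues_poly q c z 0 = 1"
  by (rule fps_ext) (simp add: rodrigues_poly_def rodrigues_coeff_def binomial_eq_0)

text \<open>
  One step of the operator that q-differentiation induces on the polynomial factor, read off
  coefficientwise from the recurrence. The identity is multiplied by \<open>(1 - q) x\<close> to avoid the division.
\<close>

lemma rodrigues_poly_Suc:
  fixes q :: "'a::field"
  assumes nr: "\<And>j. j > 0 \<Longrightarrow> q ^ j \<noteq> 1"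
    and Z: "\<And>k. 2 * k \<le> Suc m \<Longrightarrow> qpoch (z * q\<^sup>2) (q\<^sup>2) k \<noteq> 0"
  shows "fps_const (1 - q) * fps_X * rodrigues_poly q c z (Suc m) =
           (1 - fps_const (c * z * q ^ (2 * m + 1)) * fps_X\<^sup>2) * rodrigues_poly q c z m
           - (1 - fps_const c * fps_X\<^sup>2) * (rodrigues_poly q c z m oo (fps_const q * fps_X))"
    (is "?L = ?R")
proof (rule fps_ext)
  fix j
  let ?G = "\<lambda>m. rodrigues_poly q c z m"
  have R: "?R $ j = (1 - q ^ j) * ?G m $ j
      + (if j < 2 then 0 else c * (q ^ (j - 2) - z * q ^ (2 * m + 1)) * ?G m $ (j - 2))"
    by (simp only: fps_sub_nth nth_one_minus_square_mult fps_nth_compose_linear)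
       (simp add: algebra_simps)
  show "?L $ j = ?R $ j"
  proof (cases j)
    case 0
    then show ?thesis unfolding R by (simp add: mult.assoc)
  next
    case (Suc i)
    have L: "?L $ j = (1 - q) * ?G (Suc m) $ i"
      by (simp add: Suc mult.assoc)
    show ?thesis
    proof (cases "\<exists>k. Suc m = i + 2 * k")
      case False
      have off: "m \<noteq> Suc i + 2 * k" for k
      proof
        assume "m = Suc i + 2 * k"
        then have "Suc m = i + 2 * Suc k" by simp
        with False show False by blast
      qed
      have "?G (Suc m) $ i = 0" "?G m $ Suc i = 0"
        using False rodrigues_poly_nth_eq_0[OF off] rodrigues_poly_nth_eq_0[of "Suc m" i] by auto
      moreover have "?G m $ (i - 1) = 0" if "i \<ge> 1"
        using False that by (intro rodrigues_poly_nth_eq_0) (metis add_Suc le_add_diff_inverse plus_1_eq_Suc)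
      ultimately show ?thesis unfolding L R by (auto simp: Suc)
    next
      case True
      then obtain k where k: "Suc m = i + 2 * k" by blast
      have Zk: "qpoch (z * q\<^sup>2) (q\<^sup>2) k \<noteq> 0" using Z[of k] k by simp
      consider (top) "k = 0" | (bottom) k' where "k = Suc k'" "i = 0"
        | (inner) k' i' where "k = Suc k'" "i = Suc i'"
        by (meson not0_implies_Suc)
      then show ?thesis
      proof cases
        case top
        then have i: "i = Suc m" using k by simp
        have "?G m $ Suc i = 0" using i by (intro rodrigues_poly_nth_eq_0) auto
        then show ?thesis unfolding L R
          using rodrigues_coeff_top[OF nr, of c z m]
            rodrigues_poly_nth[of q c z "Suc m" 0] rodrigues_poly_nth[of q c z m 0]
          by (simp add: Suc i)
      next
        case bottom
        then have m: "m = 1 + 2 * k'" using k by simp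
        have "?G (Suc m) $ 0 = ?G m $ 1"
          using rodrigues_coeff_bottom[OF nr, of z k' c] Zk bottom k
            rodrigues_poly_nth[of q c z 0 "Suc k'"] rodrigues_poly_nth[of q c z 1 k']
          by (simp add: m)
        then show ?thesis unfolding L R by (simp add: Suc bottom)
      next
        case inner
        then have m: "m = i' + 2 * k' + 2" using k by simp
        have "?G (Suc m) $ i = rodrigues_coeff q c z (Suc i') (Suc k')"
          using rodrigues_poly_nth[of q c z "Suc i'" "Suc k'"] by (simp add: m inner)
        moreover have "?G m $ i' = rodrigues_coeff q c z i' (Suc k')"
          using rodrigues_poly_nth[of q c z "i'" "Suc k'"] by (simp add: m)
        moreover have "?G m $ (i' + 2) = rodrigues_coeff q c z (i' + 2) k'"
          using rodrigues_poly_nth[of q c z "i' + 2" "k'"] by (simp add: m)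
        moreover have "(1 - q) * rodrigues_coeff q c z (Suc i') (Suc k') =
            c * (q ^ i' - z * q ^ (2 * m + 1)) * rodrigues_coeff q c z i' (Suc k')
            + (1 - q ^ (i' + 2)) * rodrigues_coeff q c z (i' + 2) k'"
          unfolding m by (rule rodrigues_coeff_inner[OF nr Zk[unfolded inner(1)]])
        ultimately show ?thesis unfolding L R
          by (simp add: Suc inner(2))
      qed
    qed
  qed
qed

lemma qdiff_eqI:
  fixes q :: "'a::field"
  assumes "q \<noteq> 1" and "f - (f oo (fps_const q * fps_X)) = fps_const (1 - q) * fps_X * g"
  shows "qdiff q f = g"
proof -
  have d: "fps_X - fps_const q * fps_X = fps_const (1 - q) * fps_X"
    by (simp add: left_diff_distrib flip: fps_const_sub)
  have "fps_const (1 - q) * fps_X \<noteq> (0 :: 'a fps)"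
    using assms(1) by simp
  then show ?thesis
    unfolding qdiff_def assms(2) d by (rule nonzero_mult_div_cancel_left)
qed

text \<open>
  The factor that is used up by the differentiations. Its roots in \<open>x\<^sup>2\<close> are in geometric progression, so that the
  substitution \<open>x \<mapsto> q x\<close> shifts them by one place.
\<close>

definition rodrigues_kernel :: "'a::field \<Rightarrow> 'a \<Rightarrow> nat \<Rightarrow> 'a fps" where
  "rodrigues_kernel q c j = (\<Prod>k = 1..j. 1 - fps_const (q * c / q ^ (2 * k)) * fps_X\<^sup>2)"

lemma rodrigues_kernel_Suc:
  "rodrigues_kernel q c (Suc j) =
     rodrigues_kernel q c j * (1 - fps_const (q * c / q ^ (2 * Suc j)) * fps_X\<^sup>2)"
  by (simp add: rodrigues_kernel_def)

lemma compose_one_minus_square: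
  fixes q :: "'a::field"
  shows "(1 - fps_const e * fps_X\<^sup>2) oo (fps_const q * fps_X) = 1 - fps_const (e * q\<^sup>2) * fps_X\<^sup>2"
  by (rule fps_ext) (auto simp: fps_X_power_nth)

lemma rodrigues_kernel_shift:
  fixes q :: "'a::field"
  assumes "q \<noteq> 0"
  shows "rodrigues_kernel q c (Suc j) oo (fps_const q * fps_X) =
           (1 - fps_const (q * c) * fps_X\<^sup>2) * rodrigues_kernel q c j"
proof (induction j)
  case 0
  show ?case using assms
    by (simp add: rodrigues_kernel_def compose_one_minus_square)
next
  case (Suc j)
  have e: "q * c / q ^ (2 * Suc (Suc j)) * q\<^sup>2 = q * c / q ^ (2 * Suc j)"
    using assms by (simp add: field_simps power2_eq_square)
  have "rodrigues_kernel q c (Suc (Suc j)) oo (fps_const q * fps_X) =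
      (rodrigues_kernel q c (Suc j) oo (fps_const q * fps_X)) *
      ((1 - fps_const (q * c / q ^ (2 * Suc (Suc j))) * fps_X\<^sup>2) oo (fps_const q * fps_X))"
    unfolding rodrigues_kernel_Suc[of q c "Suc j"] by (rule fps_compose_mult_distrib) simp
  then show ?case
    unfolding Suc.IH compose_one_minus_square e
    by (simp only: rodrigues_kernel_Suc[of q c j] mult.assoc)
qed

text \<open>
  The q-analogue of the classical computation of \<open>D\<^sup>m ((1 - x\<^sup>2)\<^bsup>n-1/2\<^esup>)\<close>. Under \<open>x \<mapsto> q x\<close> the kernel
  gains the factor \<open>1 - q c x\<^sup>2\<close> and loses its last one, while the weight trades \<open>1 - q c x\<^sup>2\<close> for
  \<open>1 - b c x\<^sup>2\<close>. Hence weight and shortened kernel can be factored out of \<open>f(x) - f(q x)\<close>, and each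
  differentiation costs one factor of the kernel. The weight acts on the polynomial factor only through
  \<open>b\<close>, which the coefficients absorb into \<open>b c\<close> and \<open>z\<close>.
\<close>

lemma qdiff_power_weight_kernel:
  fixes q :: "'a::field"
  assumes nr: "\<And>j. j > 0 \<Longrightarrow> q ^ j \<noteq> 1" and q: "q \<noteq> 0" and b: "b \<noteq> 0"
    and W: "(1 - fps_const (q * c) * fps_X\<^sup>2) * (W oo (fps_const q * fps_X)) = (1 - fps_const (b * c) * fps_X\<^sup>2) * W"
    and z: "z = 1 / (b * q ^ (2 * n))"
    and Z: "\<And>k. 2 * k \<le> n \<Longrightarrow> qpoch (z * q\<^sup>2) (q\<^sup>2) k \<noteq> 0"
    and "m \<le> n"
  shows "(qdiff q ^^ m) (W * rodrigues_kernel q c n) =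
           W * rodrigues_kernel q c (n - m) * rodrigues_poly q (b * c) z m"
  using \<open>m \<le> n\<close>
proof (induction m)
  case 0
  show ?case by (simp add: rodrigues_poly_0)
next
  case (Suc m)
  define j where "j = n - Suc m"
  have j: "n - m = Suc j" "n = m + Suc j" using Suc.prems by (auto simp: j_def)
  let ?G = "rodrigues_poly q (b * c) z"
  let ?K = "rodrigues_kernel q c"
  let ?S = "\<lambda>f. f oo (fps_const q * fps_X)"
  have e: "q * c / q ^ (2 * Suc j) = (b * c) * z * q ^ (2 * m + 1)"
    using q b unfolding z j(2) by (simp add: field_simps power_add)
  have step: "fps_const (1 - q) * fps_X * ?G (Suc m) =
      (1 - fps_const (q * c / q ^ (2 * Suc j)) * fps_X\<^sup>2) * ?G m - (1 - fps_const (b * c) * fps_X\<^sup>2) * ?S (?G m)"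
    unfolding e using Suc.prems by (intro rodrigues_poly_Suc nr Z) auto
  have "qdiff q (W * ?K (Suc j) * ?G m) = W * ?K j * ?G (Suc m)"
  proof (rule qdiff_eqI)
    show "q \<noteq> 1" using nr[of 1] by simp
    have "?S (W * ?K (Suc j) * ?G m) = ?S W * ?S (?K (Suc j)) * ?S (?G m)"
      by (simp add: fps_compose_mult_distrib)
    also have "\<dots> = ((1 - fps_const (q * c) * fps_X\<^sup>2) * ?S W) * ?K j * ?S (?G m)"
      unfolding rodrigues_kernel_shift[OF q] by (simp only: mult_ac)
    also have "\<dots> = W * ?K j * ((1 - fps_const (b * c) * fps_X\<^sup>2) * ?S (?G m))"
      unfolding W by (simp only: mult_ac)
    finally have "W * ?K (Suc j) * ?G m - ?S (W * ?K (Suc j) * ?G m) =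
        W * ?K j * (fps_const (1 - q) * fps_X * ?G (Suc m))"
      unfolding step rodrigues_kernel_Suc by (simp only: right_diff_distrib mult_ac)
    then show "W * ?K (Suc j) * ?G m - ?S (W * ?K (Suc j) * ?G m) =
        fps_const (1 - q) * fps_X * (W * ?K j * ?G (Suc m))"
      by (simp only: mult_ac)
  qed
  then show ?case using Suc by (simp add: j(1) flip: j_def)
qed

section \<open>The two weights\<close>

text \<open>
  The functional equation \<open>h(x) / h(q\<^sup>2 x) = (1 - q x) / (1 - x)\<close> that the infinite product makes evident.
  It holds because consecutive coefficients of \<open>h\<close> have the ratio \<open>(1 - q\<^bsup>2k+1\<^esup>) / (1 - q\<^bsup>2k+2\<^esup>)\<close>.
\<close>

lemma hser_shift:
  fixes q :: "'a::field"
  assumes nr: "\<And>j. j > 0 \<Longrightarrow> q ^ j \<noteq> 1"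
  shows "(1 - fps_X) * hser q = (1 - fps_const q * fps_X) * (hser q oo (fps_const (q\<^sup>2) * fps_X))"
proof (rule fps_ext)
  fix n
  show "((1 - fps_X) * hser q) $ n = ((1 - fps_const q * fps_X) * (hser q oo (fps_const (q\<^sup>2) * fps_X))) $ n"
  proof (cases n)
    case 0
    then show ?thesis by (simp add: hser_def)
  next
    case (Suc k)
    have E: "qpoch (q\<^sup>2) (q\<^sup>2) k \<noteq> 0" for k
      by (rule qpoch_self_nonzero) (rule power_square_neq_one[OF nr])
    have "1 - (q\<^sup>2) ^ k * q\<^sup>2 \<noteq> 0"
      using E[of "Suc k"] by (simp add: qpoch_Suc)
    then show ?thesis using E[of k] unfolding Suc
      by (simp add: hser_def left_diff_distrib mult.assoc qpoch_Suc divide_simps)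
         (simp add: algebra_simps)
  qed
qed

lemma hsub_nth_0 [simp]: "hsub q c $ 0 = 1"
  by (simp add: hsub_def hser_def)

lemma hsub_compose:
  "hsub q c oo (fps_const q * fps_X) = hsub q (c * q\<^sup>2)"
proof -
  have "(fps_const c * fps_X\<^sup>2) oo (fps_const q * fps_X) = fps_const (c * q\<^sup>2) * fps_X\<^sup>2"
    by (rule fps_ext) (auto simp: fps_X_power_nth)
  then show ?thesis unfolding hsub_def
    by (subst fps_compose_assoc [symmetric]) simp_all
qed

lemma hsub_shift:
  fixes q :: "'a::field"
  assumes nr: "\<And>j. j > 0 \<Longrightarrow> q ^ j \<noteq> 1"
  shows "(1 - fps_const c * fps_X\<^sup>2) * hsub q c =
           (1 - fps_const (q * c) * fps_X\<^sup>2) * hsub q (c * q\<^sup>2)"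
proof -
  let ?y = "fps_const c * fps_X\<^sup>2 :: 'a fps"
  have y0: "?y $ 0 = 0" by simp
  have "((1 - fps_X) * hser q) oo ?y = ((1 - fps_const q * fps_X) * (hser q oo (fps_const (q\<^sup>2) * fps_X))) oo ?y"
    by (simp only: hser_shift[OF nr])
  moreover have "(hser q oo (fps_const (q\<^sup>2) * fps_X)) oo ?y = hsub q (c * q\<^sup>2)"
    unfolding hsub_def
    by (subst fps_compose_assoc [symmetric]) (simp_all add: fps_compose_mult_distrib[OF y0] mult_ac flip: fps_const_mult)
  ultimately show ?thesis
    by (simp add: fps_compose_mult_distrib[OF y0] fps_compose_sub_distrib mult_ac flip: hsub_def)
qed

text \<open>
  Shifting the argument of \<open>h\<close> by \<open>q\<^bsup>-2n\<^esup>\<close> costs a quotient of two products. The product in the Rodrigues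
  formula of the first kind cancels the denominator and leaves the kernel; for the second kind, where
  \<open>1/h\<close> occurs, it cancels the numerator instead.
\<close>

lemma hsub_mult_kernel:
  fixes q :: "'a::field"
  assumes nr: "\<And>j. j > 0 \<Longrightarrow> q ^ j \<noteq> 1" and q: "q \<noteq> 0"
  shows "hsub q (c / q ^ (2 * n)) * (\<Prod>k = 1..n. 1 - fps_const (c / q ^ (2 * k)) * fps_X\<^sup>2) =
           hsub q c * rodrigues_kernel q c n"
proof (induction n)
  case 0
  show ?case by (simp add: rodrigues_kernel_def)
next
  case (Suc n)
  let ?P = "\<Prod>k = 1..n. 1 - fps_const (c / q ^ (2 * k)) * fps_X\<^sup>2"
  have e: "c / q ^ (2 * Suc n) * q\<^sup>2 = c / q ^ (2 * n)" "q * (c / q ^ (2 * Suc n)) = q * c / q ^ (2 * Suc n)"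
    using q by (simp_all add: field_simps power2_eq_square)
  have "hsub q (c / q ^ (2 * Suc n)) * (\<Prod>k = 1..Suc n. 1 - fps_const (c / q ^ (2 * k)) * fps_X\<^sup>2)
      = ?P * ((1 - fps_const (c / q ^ (2 * Suc n)) * fps_X\<^sup>2) * hsub q (c / q ^ (2 * Suc n)))"
    by (simp add: mult_ac)
  also have "\<dots> = (hsub q (c / q ^ (2 * n)) * ?P) * (1 - fps_const (q * c / q ^ (2 * Suc n)) * fps_X\<^sup>2)"
    using hsub_shift[OF nr, of "c / q ^ (2 * Suc n)"] unfolding e by (simp only: mult_ac)
  also have "\<dots> = hsub q c * rodrigues_kernel q c (Suc n)"
    unfolding Suc.IH rodrigues_kernel_Suc by (simp only: mult_ac)
  finally show ?case .
qed

lemma hsub_weight: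
  fixes q :: "'a::field"
  assumes nr: "\<And>j. j > 0 \<Longrightarrow> q ^ j \<noteq> 1"
  shows "(1 - fps_const (q * c) * fps_X\<^sup>2) * (hsub q c oo (fps_const q * fps_X)) =
           (1 - fps_const (1 * c) * fps_X\<^sup>2) * hsub q c"
  by (simp add: hsub_compose hsub_shift[OF nr])

text \<open>
  This weight has \<open>b = q\<^sup>2\<close>, whereas \<open>h\<close> itself has \<open>b = 1\<close>.
\<close>

lemma inverse_hsub_weight:
  fixes q :: "'a::field"
  assumes nr: "\<And>j. j > 0 \<Longrightarrow> q ^ j \<noteq> 1"
  shows "(1 - fps_const (q * c) * fps_X\<^sup>2) * (inverse (hsub q (q * c)) oo (fps_const q * fps_X)) =
           (1 - fps_const (q\<^sup>2 * c) * fps_X\<^sup>2) * inverse (hsub q (q * c))"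
proof -
  let ?H = "hsub q (q * c)" and ?H' = "hsub q (q * c * q\<^sup>2)"
  have I: "?H * inverse ?H = 1" "?H' * inverse ?H' = 1"
    by (simp_all add: inverse_mult_eq_1')
  have shift: "(1 - fps_const (q * c) * fps_X\<^sup>2) * ?H = (1 - fps_const (q * (q * c)) * fps_X\<^sup>2) * ?H'"
    by (rule hsub_shift[OF nr])
  have "inverse ?H oo (fps_const q * fps_X) = inverse ?H'"
    by (subst fps_inverse_compose) (simp_all add: hsub_compose)
  then have "(1 - fps_const (q * c) * fps_X\<^sup>2) * (inverse ?H oo (fps_const q * fps_X))
      = ((1 - fps_const (q * c) * fps_X\<^sup>2) * ?H) * inverse ?H * inverse ?H'"
    using I(1) by (simp add: mult.assoc)
  also have "\<dots> = (1 - fps_const (q * (q * c)) * fps_X\<^sup>2) * inverse ?H * (?H' * inverse ?H')"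
    unfolding shift by (simp only: mult_ac)
  finally show ?thesis unfolding I by (simp add: power2_eq_square mult.assoc)
qed

lemma inverse_hsub_mult_kernel:
  fixes q :: "'a::field"
  assumes nr: "\<And>j. j > 0 \<Longrightarrow> q ^ j \<noteq> 1" and q: "q \<noteq> 0"
  shows "inverse (hsub q (q * c / q ^ (2 * n))) * rodrigues_kernel q (q * c) n =
           inverse (hsub q (q * c)) * rodrigues_kernel q c n"
proof -
  let ?H = "hsub q (q * c)" and ?H' = "hsub q (q * c / q ^ (2 * n))"
  have I: "?H * inverse ?H = 1" "?H' * inverse ?H' = 1"
    by (simp_all add: inverse_mult_eq_1')
  have conv: "?H * rodrigues_kernel q (q * c) n = ?H' * rodrigues_kernel q c n"
    using hsub_mult_kernel[OF nr q, of "q * c" n] by (simp add: rodrigues_kernel_def)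
  have "inverse ?H' * rodrigues_kernel q (q * c) n = inverse ?H' * inverse ?H * (?H * rodrigues_kernel q (q * c) n)"
    using I(1) by (simp add: mult_ac)
  also have "\<dots> = inverse ?H' * inverse ?H * (?H' * rodrigues_kernel q c n)"
    unfolding conv ..
  also have "\<dots> = inverse ?H * rodrigues_kernel q c n"
    using I(2) by (simp add: mult_ac)
  finally show ?thesis .
qed

section \<open>Coefficients at a power of q\<close>

lemma qpoch_reverse_nonzero:
  fixes q :: "'a::field"
  assumes nr: "\<And>j. j > 0 \<Longrightarrow> q ^ j \<noteq> 1" and q: "q \<noteq> 0" and "k < N"
  shows "qpoch (1 / q ^ (2 * N) * q\<^sup>2) (q\<^sup>2) k \<noteq> 0"
proof -
  have E: "qpoch (q\<^sup>2) (q\<^sup>2) k \<noteq> 0" for k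
    by (rule qpoch_self_nonzero) (rule power_square_neq_one[OF nr])
  show ?thesis
    using qpoch_reverse[of "q\<^sup>2" k N] assms(3) q E[of "N - 1"] by (auto simp: power_mult)
qed

lemma sum_descending:
  fixes k N :: nat
  assumes "k \<le> N"
  shows "2 * (\<Sum>i<k. N - 1 - i) + k * (k + 1) = 2 * k * N"
  using assms
proof (induction k)
  case (Suc k)
  then obtain r where "N = Suc k + r" by (metis le_iff_add)
  with Suc show ?case by (simp add: algebra_simps)
qed simp

text \<open>
  The total power of \<open>q\<close> that remains after all products have been reversed. The right-hand side
  contains the exponent \<open>k\<^sup>2\<close> of the q-Chebyshev polynomials; \<open>\<beta> = 0\<close> is the first kind and
  \<open>\<beta> = 1\<close> the second.
\<close>

lemma rodrigues_exponent:
  fixes i k \<beta> :: nat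
  defines "n \<equiv> i + 2 * k"
  assumes "k \<le> n + \<beta>" and "n \<le> 2 * (n + \<beta>)"
  shows "n * (n + 1) + 2 * \<beta> * (i + k) + (i choose 2) + 2 * (\<Sum>j<k. n + \<beta> - 1 - j) =
           n + (\<Sum>j<n. 2 * (n + \<beta>) - 1 - j) + k\<^sup>2"
proof -
  define e1 where "e1 = (\<Sum>j<n. 2 * (n + \<beta>) - 1 - j)"
  define e2 where "e2 = (\<Sum>j<k. n + \<beta> - 1 - j)"
  have e: "2 * e1 + n * (n + 1) = 2 * n * (2 * (n + \<beta>))" "2 * e2 + k * (k + 1) = 2 * k * (n + \<beta>)"
    using sum_descending[of n "2 * (n + \<beta>)"] sum_descending[of k "n + \<beta>"] assms(2,3)
    by (simp_all add: e1_def e2_def)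
  have c: "2 * (i choose 2) + i = i * i"
    by (induction i) (auto simp: numeral_2_eq_2)
  have "2 * (n * (n + 1) + 2 * \<beta> * (i + k) + (i choose 2) + 2 * e2) + (i + 2 * (k * (k + 1)) + n * (n + 1))
      = 2 * (n + e1 + k\<^sup>2) + (i + 2 * (k * (k + 1)) + n * (n + 1))"
  proof -
    have "2 * (n * (n + 1) + 2 * \<beta> * (i + k) + (i choose 2) + 2 * e2) + (i + 2 * (k * (k + 1)) + n * (n + 1))
      = 3 * (n * (n + 1)) + 4 * \<beta> * (i + k) + (2 * (i choose 2) + i) + 2 * (2 * e2 + k * (k + 1))"
      by (simp add: algebra_simps)
    also have "\<dots> = 2 * n + (2 * e1 + n * (n + 1)) + 2 * k\<^sup>2 + (i + 2 * (k * (k + 1)))"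
      unfolding e c by (simp add: n_def algebra_simps power2_eq_square)
    finally show ?thesis by (simp add: algebra_simps)
  qed
  then have "n * (n + 1) + 2 * \<beta> * (i + k) + (i choose 2) + 2 * e2 = n + e1 + k\<^sup>2"
    by (simp only: add_right_cancel mult_cancel_left numeral_neq_zero simp_thms)
  then show ?thesis unfolding e1_def e2_def .
qed

text \<open>
  At \<open>z = q\<^bsup>-2N\<^esup>\<close> both products with \<open>z\<close> can be reversed, and \<open>(q;q)\<^bsub>2N-1\<^esub>\<close> splits into even
  and odd factors. The even ones cancel and the odd ones give the normalisation. Here \<open>N = n + \<beta>\<close>, because
  \<open>z = 1 / (b q\<^bsup>2n\<^esup>)\<close> with \<open>b = q\<^bsup>2\<beta>\<^esup>\<close>.
\<close>

lemma rodrigues_coeff_eval: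
  fixes q s :: "'a::field"
  assumes nr: "\<And>j. j > 0 \<Longrightarrow> q ^ j \<noteq> 1" and q: "q \<noteq> 0" and s: "s \<noteq> 0"
    and n: "n = i + 2 * k" and pos: "0 < n + \<beta>"
  shows "q ^ (n * (n + 1)) * (s / q) ^ n * rodrigues_coeff q (- (q ^ (2 * \<beta>)) / s) (1 / q ^ (2 * (n + \<beta>))) i k =
      (\<Prod>k = 1..n + \<beta>. qnum q (2 * k - 1)) * (1 - q) ^ \<beta> * q ^ k\<^sup>2 * s ^ k
      * (qpoch (q\<^sup>2) (q\<^sup>2) (n + \<beta> - 1 - k) * qpoch q q n
         / (qpoch q q (n + 2 * \<beta> - 1) * qpoch (q\<^sup>2) (q\<^sup>2) k * qpoch q q i))"
proof -
  let ?F = "qpoch q q" and ?E = "qpoch (q\<^sup>2) (q\<^sup>2)"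
  define N where "N = n + \<beta>"
  have k: "k < N" "n < 2 * N" using n pos by (auto simp: N_def)
  define e1 where "e1 = (\<Sum>j<n. 2 * N - 1 - j)"
  define e2 where "e2 = (\<Sum>i<k. N - 1 - i)"
  define Q where "Q = (\<Prod>k = 1..N. qnum q (2 * k - 1))"
  define Z where "Z = qpoch (1 / q ^ (2 * N) * q) q n"
  define Y where "Y = qpoch (1 / q ^ (2 * N) * q\<^sup>2) (q\<^sup>2) k"
  have q1: "1 - q \<noteq> 0" using nr[of 1] by simp
  have F: "?F j \<noteq> 0" for j by (rule qpoch_self_nonzero[OF nr])
  have E: "?E j \<noteq> 0" for j
    by (rule qpoch_self_nonzero) (rule power_square_neq_one[OF nr])
  have Z: "Z * q ^ e1 * ?F (n + 2 * \<beta> - 1) = (- 1) ^ n * ?F (2 * N - 1)"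
  proof -
    have "2 * N - 1 - n = n + 2 * \<beta> - 1" by (simp add: N_def)
    then show ?thesis using qpoch_reverse[OF q k(2)] by (simp add: Z_def e1_def)
  qed
  have Y: "Y * q ^ (2 * e2) * ?E (N - 1 - k) = (- 1) ^ k * ?E (N - 1)"
    using qpoch_reverse[of "q\<^sup>2" k N] k q by (simp add: Y_def e2_def power_mult)
  have O: "?F (2 * N - 1) = ?E (N - 1) * ((1 - q) ^ N * Q)"
  proof -
    have "2 * (N - 1) + 1 = 2 * N - 1" "Suc (N - 1) = N" using k by auto
    then show ?thesis using qpoch_odd[of q "N - 1"] q1 by (simp add: Q_def)
  qed
  have ZY: "Z = (- 1) ^ n * ?E (N - 1) * ((1 - q) ^ N * Q) / (q ^ e1 * ?F (n + 2 * \<beta> - 1))"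
    "Y = (- 1) ^ k * ?E (N - 1) / (q ^ (2 * e2) * ?E (N - 1 - k))"
  proof -
    have nz: "q ^ e1 * ?F (n + 2 * \<beta> - 1) \<noteq> 0" "q ^ (2 * e2) * ?E (N - 1 - k) \<noteq> 0"
      using q F E by simp_all
    show "Z = (- 1) ^ n * ?E (N - 1) * ((1 - q) ^ N * Q) / (q ^ e1 * ?F (n + 2 * \<beta> - 1))"
      unfolding nonzero_eq_divide_eq[OF nz(1)] using Z unfolding O by (simp only: mult.assoc)
    show "Y = (- 1) ^ k * ?E (N - 1) / (q ^ (2 * e2) * ?E (N - 1 - k))"
      unfolding nonzero_eq_divide_eq[OF nz(2)] using Y by (simp only: mult.assoc)
  qed
  \<comment> \<open>The signs of the reversed products cancel those of \<open>- 1 / s\<close>, since \<open>n + i\<close> is even.\<close>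
  have sg: "(- (q ^ (2 * \<beta>)) / s) ^ (i + k) * (- 1) ^ n / (- 1) ^ k = q ^ (2 * \<beta> * (i + k)) / s ^ (i + k)"
  proof -
    define X where "X = q ^ (2 * \<beta> * (i + k)) / s ^ (i + k)"
    have "(- (q ^ (2 * \<beta>)) / s) ^ (i + k) = (- 1) ^ (i + k) * X"
      unfolding X_def by (subst power_minus[of "q ^ (2 * \<beta>) / s", simplified minus_divide_left]) (simp add: power_divide power_mult)
    moreover have "(- 1 :: 'a) ^ (i + k) * (- 1) ^ n / (- 1) ^ k = 1"
      by (simp add: n power_add power_mult flip: power_mult_distrib)
    moreover have "(- 1) ^ (i + k) * X * (- 1) ^ n / (- 1) ^ k = (- 1) ^ (i + k) * (- 1) ^ n / (- 1) ^ k * X"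
      by (simp only: times_divide_eq_left times_divide_eq_right mult_ac)
    ultimately show ?thesis unfolding X_def[symmetric] by (simp only: mult_1_left)
  qed
  have ex: "q ^ (n * (n + 1)) * q ^ (2 * \<beta> * (i + k)) * q ^ (i choose 2) * q ^ (2 * e2) = q ^ n * q ^ e1 * q ^ k\<^sup>2"
    unfolding power_add[symmetric] e1_def e2_def N_def n
    by (intro arg_cong[where f = "\<lambda>e. q ^ e"] rodrigues_exponent) simp_all
  have "rodrigues_coeff q (- (q ^ (2 * \<beta>)) / s) (1 / q ^ (2 * N)) i k
      = (- (q ^ (2 * \<beta>)) / s) ^ (i + k) * q ^ (i choose 2) * Z * ?F n / ((1 - q) ^ n * Y * ?E k * ?F i)"
    by (simp add: rodrigues_coeff_def Z_def Y_def n)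
  also have "\<dots> = ((- (q ^ (2 * \<beta>)) / s) ^ (i + k) * (- 1) ^ n / (- 1) ^ k) * Q * (1 - q) ^ \<beta>
      * q ^ (i choose 2) * q ^ (2 * e2) / q ^ e1
      * (?E (N - 1 - k) * ?F n / (?F (n + 2 * \<beta> - 1) * ?E k * ?F i))"
    unfolding ZY using q q1 F E by (simp add: divide_simps N_def power_add)
  finally have R: "rodrigues_coeff q (- (q ^ (2 * \<beta>)) / s) (1 / q ^ (2 * N)) i k
      = ((- (q ^ (2 * \<beta>)) / s) ^ (i + k) * (- 1) ^ n / (- 1) ^ k) * Q * (1 - q) ^ \<beta>
      * q ^ (i choose 2) * q ^ (2 * e2) / q ^ e1
      * (?E (N - 1 - k) * ?F n / (?F (n + 2 * \<beta> - 1) * ?E k * ?F i))" .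
  have "q ^ (n * (n + 1)) * (s / q) ^ n * rodrigues_coeff q (- (q ^ (2 * \<beta>)) / s) (1 / q ^ (2 * N)) i k
      = (q ^ (n * (n + 1)) * q ^ (2 * \<beta> * (i + k)) * q ^ (i choose 2) * q ^ (2 * e2)) / (q ^ n * q ^ e1)
        * (s ^ n / s ^ (i + k)) * Q * (1 - q) ^ \<beta>
        * (?E (N - 1 - k) * ?F n / (?F (n + 2 * \<beta> - 1) * ?E k * ?F i))"
    unfolding R sg
    by (simp only: power_divide[of s q] times_divide_eq_left times_divide_eq_right divide_divide_eq_left mult_ac)
  moreover have "s ^ n / s ^ (i + k) = s ^ k"
    using s by (simp add: n power_add mult_2)
  ultimately show ?thesis
    unfolding ex N_def[symmetric] Q_def[symmetric] using q by simp
qed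

lemma qpoch_add: "qpoch a q (m + k) = qpoch a q m * qpoch (q ^ m * a) q k"
  by (induction k) (auto simp: qpoch_Suc power_add mult_ac)

lemma qpoch_minus_prod: "qpoch (- q) q (k + i) = qpoch (- q) q k * (\<Prod>j = k + 1..k + i. 1 + q ^ j)"
  by (induction i) (auto simp: qpoch_Suc mult_ac)

text \<open>
  The factor \<open>[n-k]\<close> cancels the last factor of \<open>(q;q)\<^bsub>n-k\<^esub>\<close>, and the products with plus signs pair
  with those with minus signs by \<open>(1 - q\<^sup>j) (1 + q\<^sup>j) = 1 - q\<^bsup>2j\<^esup>\<close>.
\<close>

lemma qcheb_T_coeff:
  fixes q s :: "'a::field"
  assumes nr: "\<And>j. j > 0 \<Longrightarrow> q ^ j \<noteq> 1"
    and n: "n = i + 2 * k" and pos: "0 < n"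
  shows "q ^ (k ^ 2) * (qnum q n / qnum q (n - k)) * qbinom q (n - k) k
            * (qpoch (- q) q (n - 1) / (qpoch (- q) q k * qpoch (- (q ^ (n - k))) q k)) * s ^ k
         = q ^ k\<^sup>2 * s ^ k * ((1 - q ^ n) * qpoch (q\<^sup>2) (q\<^sup>2) (n - 1 - k) / (qpoch (q\<^sup>2) (q\<^sup>2) k * qpoch q q i))"
proof -
  obtain r where r: "n - k = Suc r" "n - 1 - k = r" "n - 1 = r + k" "Suc r - k = i"
  proof
    show "n - k = Suc (n - 1 - k)" "n - 1 = (n - 1 - k) + k" "Suc (n - 1 - k) - k = i"
      using n pos by auto
  qed simp
  have q1: "1 - q \<noteq> 0" using nr[of 1] by simp
  have F: "qpoch q q j \<noteq> 0" for j by (rule qpoch_self_nonzero[OF nr])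
  have E: "qpoch (q\<^sup>2) (q\<^sup>2) j \<noteq> 0" for j
    by (rule qpoch_self_nonzero) (rule power_square_neq_one[OF nr])
  have M: "qpoch (- q) q j \<noteq> 0" for j
    using E[of j] by (auto simp: qpoch_square)
  have split: "qpoch (- q) q (r + k) = qpoch (- q) q r * qpoch (- (q ^ Suc r)) q k"
    by (simp add: qpoch_add mult.commute)
  have "qpoch (- (q ^ Suc r)) q k \<noteq> 0"
    using M[of "r + k"] by (auto simp: split)
  moreover have "1 - q ^ Suc r \<noteq> 0" using nr[of "Suc r"] by simp
  ultimately show ?thesis
    unfolding r qnum_def qbinom_def split qpoch_square qpoch_Suc[of q q r] using q1 F M
    by (simp add: divide_simps)
qed

lemma qcheb_U_coeff:
  fixes q s :: "'a::field"
  assumes nr: "\<And>j. j > 0 \<Longrightarrow> q ^ j \<noteq> 1" and n: "n = i + 2 * k"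
  shows "q ^ (k ^ 2) * qbinom q (n - k) k * (\<Prod>j = k + 1..n - k. 1 + q ^ j) * s ^ k
         = q ^ k\<^sup>2 * s ^ k * (qpoch (q\<^sup>2) (q\<^sup>2) (n - k) / (qpoch (q\<^sup>2) (q\<^sup>2) k * qpoch q q i))"
proof -
  have r: "n - k = k + i" "k + i - k = i" using n by auto
  have E: "qpoch (q\<^sup>2) (q\<^sup>2) j \<noteq> 0" for j
    by (rule qpoch_self_nonzero) (rule power_square_neq_one[OF nr])
  have "qpoch (- q) q k \<noteq> 0" "qpoch q q k \<noteq> 0"
    using E[of k] by (auto simp: qpoch_square)
  then show ?thesis
    unfolding r qbinom_def qpoch_square qpoch_minus_prod[of q k i] by (simp add: divide_simps)
qed

lemma qnum_nonzero:
  fixes q :: "'a::field"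
  assumes nr: "\<And>j. j > 0 \<Longrightarrow> q ^ j \<noteq> 1" and "j > 0"
  shows "qnum q j \<noteq> 0"
  using nr[of 1] nr[OF assms(2)] by (simp add: qnum_def)

lemma fps_of_poly_eq_rodrigues_poly:
  fixes q :: "'a::field"
  assumes t: "\<And>i k. n = i + 2 * k \<Longrightarrow> t k = C * rodrigues_coeff q c z i k"
  shows "fps_of_poly (\<Sum>k = 0..n div 2. monom (t k) (n - 2 * k)) = fps_const C * rodrigues_poly q c z n"
proof (rule fps_ext)
  fix j
  have S: "fps_of_poly (\<Sum>k = 0..n div 2. monom (t k) (n - 2 * k)) $ j =
      (\<Sum>k = 0..n div 2. if n - 2 * k = j then t k else 0)"
    by (simp add: coeff_sum)
  show "fps_of_poly (\<Sum>k = 0..n div 2. monom (t k) (n - 2 * k)) $ j = (fps_const C * rodrigues_poly q c z n) $ j"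
  proof (cases "\<exists>k. n = j + 2 * k")
    case True
    then obtain k where k: "n = j + 2 * k" by blast
    have "(\<Sum>k' = 0..n div 2. if n - 2 * k' = j then t k' else 0) = (\<Sum>k' = 0..n div 2. if k' = k then t k' else 0)"
      by (rule sum.cong) (auto simp: k)
    also have "\<dots> = t k" by (simp add: k)
    finally show ?thesis
      unfolding S using t[OF k] by (simp add: k rodrigues_poly_nth)
  next
    case False
    have "n - 2 * k \<noteq> j" if "k \<in> {0..n div 2}" for k
    proof
      assume "n - 2 * k = j"
      then have "n = j + 2 * k" using that by auto
      with False show False by blast
    qed
    then have "(\<Sum>k = 0..n div 2. if n - 2 * k = j then t k else 0) = 0"
      by (intro sum.neutral) simp
    then show ?thesis
      unfolding S using rodrigues_poly_nth_eq_0[of n j] False by auto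
  qed
qed

section \<open>The Rodrigues formulas\<close>

lemma qdiff_power_weight_kernel_full:
  fixes q :: "'a::field"
  assumes nr: "\<And>j. j > 0 \<Longrightarrow> q ^ j \<noteq> 1" and q: "q \<noteq> 0" and b: "b \<noteq> 0"
    and W: "(1 - fps_const (q * c) * fps_X\<^sup>2) * (W oo (fps_const q * fps_X)) = (1 - fps_const (b * c) * fps_X\<^sup>2) * W"
    and z: "z = 1 / (b * q ^ (2 * n))"
    and Z: "\<And>k. 2 * k \<le> n \<Longrightarrow> qpoch (z * q\<^sup>2) (q\<^sup>2) k \<noteq> 0"
  shows "(qdiff q ^^ n) (W * rodrigues_kernel q c n) = W * rodrigues_poly q (b * c) z n"
  using qdiff_power_weight_kernel[OF nr q b W z Z order.refl] by (simp add: rodrigues_kernel_def)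

lemma one_divide_hsub: "1 / hsub q c = inverse (hsub q c)"
  by (simp add: fps_divide_unit)

lemma prod_affine_square:
  fixes a :: "'a::field"
  assumes "a \<noteq> 0"
  shows "(\<Prod>k = 1..n. fps_const (e k) * fps_X\<^sup>2 + fps_const a) =
           fps_const (a ^ n) * (\<Prod>k = 1..n. 1 - fps_const (- e k / a) * fps_X\<^sup>2)"
proof -
  have "fps_const (e k) * fps_X\<^sup>2 + fps_const a = fps_const a * (1 - fps_const (- e k / a) * fps_X\<^sup>2)" for k
    using assms by (intro fps_ext) (simp add: right_diff_distrib fps_X_power_nth flip: mult.assoc)
  then show ?thesis
    by (simp only: prod.distrib prod_constant fps_const_power card_atLeastAtMost diff_Suc_1)
qed

text \<open>
  This lets the constant \<open>(s/q)\<^sup>n\<close> be carried through \<open>D\<^sup>n\<close> as part of the weight.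
\<close>

lemma weight_scale:
  fixes W :: "'a::field fps"
  assumes "A * (W oo (fps_const q * fps_X)) = B * W"
  shows "A * ((fps_const a * W) oo (fps_const q * fps_X)) = B * (fps_const a * W)"
  using assms by (simp add: fps_compose_mult_distrib mult.left_commute)

lemma weight_cancel:
  fixes V W :: "'a::field fps"
  assumes "V * W = 1"
  shows "fps_const (A * a) * R = fps_const A * V * (fps_const a * W * R)"
proof -
  have "fps_const A * V * (fps_const a * W * R) = (fps_const A * fps_const a) * ((V * W) * R)"
    by (simp only: mult_ac)
  then show ?thesis unfolding assms fps_const_mult mult_1_left by (rule sym)
qed

theorem qcheb_T_rodrigues:
  fixes q s :: "'a::field"
  assumes nr: "\<And>j. j > 0 \<Longrightarrow> q ^ j \<noteq> 1" and q: "q \<noteq> 0" and s: "s \<noteq> 0"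
  shows "fps_of_poly (qcheb_T n s q) =
           fps_const (q ^ (n * (n + 1)) / (\<Prod>k = 1..n. qnum q (2 * k - 1)))
           * (1 / hsub q (- (1 / s)))
           * (qdiff q ^^ n)
               (hsub q (- (1 / (q ^ (2 * n) * s)))
                * (\<Prod>k = 1..n. fps_const (1 / q ^ (2 * k + 1)) * fps_X ^ 2 + fps_const (s / q)))"
proof (cases "n = 0")
  case True
  then show ?thesis by (simp add: qcheb_T_def one_divide_hsub inverse_mult_eq_1)
next
  case False
  define c where "c = - 1 / s"
  define z where "z = 1 / q ^ (2 * (n + 0))"
  let ?H = "hsub q c"
  let ?a = "(s / q) ^ n"
  let ?Q = "\<Prod>k = 1..n. qnum q (2 * k - 1)"
  have e: "- (1 / q ^ (2 * k + 1)) / (s / q) = c / q ^ (2 * k)" for k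
    using q s by (simp add: c_def field_simps)
  have "hsub q (- (1 / (q ^ (2 * n) * s)))
          * (\<Prod>k = 1..n. fps_const (1 / q ^ (2 * k + 1)) * fps_X ^ 2 + fps_const (s / q))
      = fps_const ?a * (hsub q (c / q ^ (2 * n)) * (\<Prod>k = 1..n. 1 - fps_const (c / q ^ (2 * k)) * fps_X\<^sup>2))"
    using q s by (subst prod_affine_square) (simp_all add: e c_def field_simps)
  also have "\<dots> = (fps_const ?a * ?H) * rodrigues_kernel q c n"
    using hsub_mult_kernel[OF nr q, of c n] by (simp add: mult.assoc)
  finally have arg: "hsub q (- (1 / (q ^ (2 * n) * s)))
          * (\<Prod>k = 1..n. fps_const (1 / q ^ (2 * k + 1)) * fps_X ^ 2 + fps_const (s / q))
      = (fps_const ?a * ?H) * rodrigues_kernel q c n" .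
  have D: "(qdiff q ^^ n) ((fps_const ?a * ?H) * rodrigues_kernel q c n) =
      (fps_const ?a * ?H) * rodrigues_poly q (1 * c) z n"
  proof (rule qdiff_power_weight_kernel_full[OF nr q])
    show "(1 - fps_const (q * c) * fps_X\<^sup>2) * ((fps_const ?a * ?H) oo (fps_const q * fps_X)) =
        (1 - fps_const (1 * c) * fps_X\<^sup>2) * (fps_const ?a * ?H)"
      by (rule weight_scale[OF hsub_weight[OF nr]])
    show "qpoch (z * q\<^sup>2) (q\<^sup>2) k \<noteq> 0" if "2 * k \<le> n" for k
      unfolding z_def using that False by (intro qpoch_reverse_nonzero[OF nr q]) auto
  qed (simp_all add: z_def)
  have coeff: "q ^ (k ^ 2) * (qnum q n / qnum q (n - k)) * qbinom q (n - k) k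
            * (qpoch (- q) q (n - 1) / (qpoch (- q) q k * qpoch (- (q ^ (n - k))) q k)) * s ^ k
         = q ^ (n * (n + 1)) / ?Q * ?a * rodrigues_coeff q c z i k" if n: "n = i + 2 * k" for i k
  proof -
    have Q: "?Q \<noteq> 0" by (simp add: prod_zero_iff qnum_nonzero[OF nr])
    obtain m where m: "n = Suc m" using False not0_implies_Suc by blast
    have F: "qpoch q q n = qpoch q q (n - 1) * (1 - q ^ n)"
      by (simp add: m qpoch_Suc mult.commute)
    have F0: "qpoch q q (n - 1) \<noteq> 0" by (rule qpoch_self_nonzero[OF nr])
    have "q ^ (n * (n + 1)) * ?a * rodrigues_coeff q c z i k = ?Q * q ^ k\<^sup>2 * s ^ k
      * (qpoch (q\<^sup>2) (q\<^sup>2) (n - 1 - k) * qpoch q q n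
         / (qpoch q q (n - 1) * qpoch (q\<^sup>2) (q\<^sup>2) k * qpoch q q i))"
      using rodrigues_coeff_eval[OF nr q s n, of 0] False by (simp add: z_def c_def)
    also have "\<dots> = ?Q * (q ^ k\<^sup>2 * s ^ k
        * ((1 - q ^ n) * qpoch (q\<^sup>2) (q\<^sup>2) (n - 1 - k) / (qpoch (q\<^sup>2) (q\<^sup>2) k * qpoch q q i)))"
      unfolding F using F0 by simp
    also have "q ^ k\<^sup>2 * s ^ k
        * ((1 - q ^ n) * qpoch (q\<^sup>2) (q\<^sup>2) (n - 1 - k) / (qpoch (q\<^sup>2) (q\<^sup>2) k * qpoch q q i))
      = q ^ (k ^ 2) * (qnum q n / qnum q (n - k)) * qbinom q (n - k) k
            * (qpoch (- q) q (n - 1) / (qpoch (- q) q k * qpoch (- (q ^ (n - k))) q k)) * s ^ k"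
      using False by (intro qcheb_T_coeff[OF nr n, symmetric]) simp_all
    finally have eval: "q ^ (n * (n + 1)) * ?a * rodrigues_coeff q c z i k = ?Q * (q ^ (k ^ 2)
            * (qnum q n / qnum q (n - k)) * qbinom q (n - k) k
            * (qpoch (- q) q (n - 1) / (qpoch (- q) q k * qpoch (- (q ^ (n - k))) q k)) * s ^ k)" .
    have "q ^ (n * (n + 1)) / ?Q * ?a * rodrigues_coeff q c z i k
        = q ^ (n * (n + 1)) * ?a * rodrigues_coeff q c z i k / ?Q"
      by (simp only: times_divide_eq_left)
    also have "\<dots> = q ^ (k ^ 2) * (qnum q n / qnum q (n - k)) * qbinom q (n - k) k
            * (qpoch (- q) q (n - 1) / (qpoch (- q) q k * qpoch (- (q ^ (n - k))) q k)) * s ^ k"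
      unfolding eval using Q by (rule nonzero_mult_div_cancel_left)
    finally show ?thesis ..
  qed
  have "fps_of_poly (qcheb_T n s q) = fps_const (q ^ (n * (n + 1)) / ?Q * ?a) * rodrigues_poly q c z n"
    unfolding qcheb_T_def if_not_P[OF False] using coeff by (rule fps_of_poly_eq_rodrigues_poly)
  also have "\<dots> = fps_const (q ^ (n * (n + 1)) / ?Q) * inverse ?H
      * (qdiff q ^^ n) ((fps_const ?a * ?H) * rodrigues_kernel q c n)"
    unfolding D mult_1_left by (rule weight_cancel) (simp add: inverse_mult_eq_1)
  finally show ?thesis unfolding arg one_divide_hsub by (simp only: c_def minus_divide_left)
qed

theorem qcheb_U_rodrigues:
  fixes q s :: "'a::field"
  assumes nr: "\<And>j. j > 0 \<Longrightarrow> q ^ j \<noteq> 1" and q: "q \<noteq> 0" and s: "s \<noteq> 0"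
  shows "fps_of_poly (qcheb_U n s q) =
           fps_const (q ^ (n * (n + 1)) * qnum q (n + 1) / (\<Prod>k = 1..n. qnum q (2 * k + 1)))
           * hsub q (- (q / s))
           * (qdiff q ^^ n)
               (1 / hsub q (- (1 / (q powi (2 * int n - 1) * s)))
                * (\<Prod>k = 1..n. fps_const (1 / q ^ (2 * k - 1)) * fps_X ^ 2 + fps_const (s / q)))"
proof -
  define c where "c = - 1 / s"
  define z where "z = 1 / q ^ (2 * (n + 1))"
  let ?H = "hsub q (q * c)"
  let ?a = "(s / q) ^ n"
  let ?Q = "\<Prod>k = 1..n. qnum q (2 * k + 1)"
  have e: "- (1 / q ^ (2 * k - 1)) / (s / q) = q * (q * c) / q ^ (2 * k)" if k: "k \<in> {1..n}" for k
  proof -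
    obtain l where "k = Suc l" using k by (cases k) auto
    then show ?thesis using q s by (simp add: c_def field_simps)
  qed
  have pi: "- (1 / (q powi (2 * int n - 1) * s)) = q * c / q ^ (2 * n)"
  proof -
    have "q powi (2 * int n - 1) = q ^ (2 * n) / q"
      using q power_int_diff[of q "2 * int n" 1] power_int_of_nat[of q "2 * n"] by simp
    then show ?thesis using q s by (simp add: c_def)
  qed
  have "(\<Prod>k = 1..n. fps_const (1 / q ^ (2 * k - 1)) * fps_X ^ 2 + fps_const (s / q))
      = fps_const ?a * (\<Prod>k = 1..n. 1 - fps_const (- (1 / q ^ (2 * k - 1)) / (s / q)) * fps_X\<^sup>2)"
    using q s by (intro prod_affine_square) simp
  also have "\<dots> = fps_const ?a * rodrigues_kernel q (q * c) n"
    unfolding rodrigues_kernel_def by (simp only: e cong: prod.cong)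
  finally have "1 / hsub q (- (1 / (q powi (2 * int n - 1) * s)))
          * (\<Prod>k = 1..n. fps_const (1 / q ^ (2 * k - 1)) * fps_X ^ 2 + fps_const (s / q))
      = fps_const ?a * (inverse (hsub q (q * c / q ^ (2 * n))) * rodrigues_kernel q (q * c) n)"
    unfolding pi one_divide_hsub by (simp only: mult_ac)
  also have "\<dots> = (fps_const ?a * inverse ?H) * rodrigues_kernel q c n"
    using inverse_hsub_mult_kernel[OF nr q, of c n] by (simp add: mult.assoc)
  finally have arg: "1 / hsub q (- (1 / (q powi (2 * int n - 1) * s)))
          * (\<Prod>k = 1..n. fps_const (1 / q ^ (2 * k - 1)) * fps_X ^ 2 + fps_const (s / q))
      = (fps_const ?a * inverse ?H) * rodrigues_kernel q c n" .
  have D: "(qdiff q ^^ n) ((fps_const ?a * inverse ?H) * rodrigues_kernel q c n) =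
      (fps_const ?a * inverse ?H) * rodrigues_poly q (q\<^sup>2 * c) z n"
  proof (rule qdiff_power_weight_kernel_full[OF nr q])
    show "(1 - fps_const (q * c) * fps_X\<^sup>2) * ((fps_const ?a * inverse ?H) oo (fps_const q * fps_X)) =
        (1 - fps_const (q\<^sup>2 * c) * fps_X\<^sup>2) * (fps_const ?a * inverse ?H)"
      by (rule weight_scale[OF inverse_hsub_weight[OF nr]])
    show "qpoch (z * q\<^sup>2) (q\<^sup>2) k \<noteq> 0" if "2 * k \<le> n" for k
      unfolding z_def using that by (intro qpoch_reverse_nonzero[OF nr q]) auto
    show "z = 1 / (q\<^sup>2 * q ^ (2 * n))" by (simp add: z_def power2_eq_square)
  qed (simp_all add: q)
  have coeff: "q ^ (k ^ 2) * qbinom q (n - k) k * (\<Prod>j = k + 1..n - k. 1 + q ^ j) * s ^ k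
         = q ^ (n * (n + 1)) * qnum q (n + 1) / ?Q * ?a * rodrigues_coeff q (q\<^sup>2 * c) z i k"
    if n: "n = i + 2 * k" for i k
  proof -
    have Q: "?Q \<noteq> 0" by (simp add: prod_zero_iff qnum_nonzero[OF nr])
    \<comment> \<open>The normalisation for \<open>N = n + 1\<close> is \<open>[1][3]\<dots>[2n+1]\<close>, and \<open>[1] = 1\<close>.\<close>
    have Q1: "(\<Prod>k = 1..n + 1. qnum q (2 * k - 1)) = ?Q"
    proof -
      have "(\<Prod>k = 1..n + 1. qnum q (2 * k - 1)) = qnum q 1 * (\<Prod>k = Suc 1..Suc n. qnum q (2 * k - 1))"
        by (simp add: prod.atLeast_Suc_atMost)
      also have "\<dots> = ?Q"
        unfolding prod.shift_bounds_cl_Suc_ivl using nr[of 1] by (simp add: qnum_def)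
      finally show ?thesis .
    qed
    have b: "- (q ^ (2 * 1)) / s = q\<^sup>2 * c" by (simp add: c_def)
    have q1: "1 - q \<noteq> 0" "1 - q ^ (n + 1) \<noteq> 0" using nr[of 1] nr[of "n + 1"] by auto
    \<comment> \<open>The quotient \<open>(q;q)\<^sub>n / (q;q)\<^bsub>n+1\<^esub>\<close> accounts for the factor \<open>[n+1]\<close> of the formula.\<close>
    have F: "qpoch q q (n + 2 * 1 - 1) = qpoch q q n * (1 - q ^ (n + 1))"
      by (simp add: qpoch_Suc mult.commute)
    have "q ^ (n * (n + 1)) * ?a * rodrigues_coeff q (q\<^sup>2 * c) z i k =
      ?Q * (1 - q) ^ 1 * q ^ k\<^sup>2 * s ^ k
      * (qpoch (q\<^sup>2) (q\<^sup>2) (n + 1 - 1 - k) * qpoch q q n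
         / (qpoch q q (n + 2 * 1 - 1) * qpoch (q\<^sup>2) (q\<^sup>2) k * qpoch q q i))"
      using rodrigues_coeff_eval[OF nr q s n, of 1] unfolding Q1 b z_def[symmetric] by simp
    also have "\<dots> = ?Q / qnum q (n + 1) *
        (q ^ k\<^sup>2 * s ^ k * (qpoch (q\<^sup>2) (q\<^sup>2) (n - k) / (qpoch (q\<^sup>2) (q\<^sup>2) k * qpoch q q i)))"
      unfolding F qnum_def[of q "n + 1"] using q1 qpoch_self_nonzero[OF nr, of n] by simp
    also have "q ^ k\<^sup>2 * s ^ k * (qpoch (q\<^sup>2) (q\<^sup>2) (n - k) / (qpoch (q\<^sup>2) (q\<^sup>2) k * qpoch q q i))
      = q ^ (k ^ 2) * qbinom q (n - k) k * (\<Prod>j = k + 1..n - k. 1 + q ^ j) * s ^ k"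
      by (rule qcheb_U_coeff[OF nr n, symmetric])
    finally have eval: "q ^ (n * (n + 1)) * ?a * rodrigues_coeff q (q\<^sup>2 * c) z i k
      = ?Q / qnum q (n + 1) * (q ^ (k ^ 2) * qbinom q (n - k) k * (\<Prod>j = k + 1..n - k. 1 + q ^ j) * s ^ k)" .
    have "q ^ (n * (n + 1)) * qnum q (n + 1) / ?Q * ?a * rodrigues_coeff q (q\<^sup>2 * c) z i k
      = (q ^ (n * (n + 1)) * ?a * rodrigues_coeff q (q\<^sup>2 * c) z i k) * (qnum q (n + 1) / ?Q)"
      by (simp only: times_divide_eq_left times_divide_eq_right mult_ac)
    also have "\<dots> = q ^ (k ^ 2) * qbinom q (n - k) k * (\<Prod>j = k + 1..n - k. 1 + q ^ j) * s ^ k"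
      unfolding eval using Q qnum_nonzero[OF nr, of "n + 1"] by simp
    finally show ?thesis ..
  qed
  have Hc: "- (q / s) = q * c" by (simp add: c_def)
  have "fps_of_poly (qcheb_U n s q) =
      fps_const (q ^ (n * (n + 1)) * qnum q (n + 1) / ?Q * ?a) * rodrigues_poly q (q\<^sup>2 * c) z n"
    unfolding qcheb_U_def using coeff by (rule fps_of_poly_eq_rodrigues_poly)
  also have "\<dots> = fps_const (q ^ (n * (n + 1)) * qnum q (n + 1) / ?Q) * ?H
      * (qdiff q ^^ n) ((fps_const ?a * inverse ?H) * rodrigues_kernel q c n)"
    unfolding D by (rule weight_cancel) (simp add: inverse_mult_eq_1')
  finally show ?thesis unfolding arg Hc .
qed

lemma indet_q_power: "indet_q ^ j = (to_fract [:monom 1 j:] :: 'k::field_char_0 poly poly fract)"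
proof (induction j)
  case 0
  show ?case by (simp flip: to_fract_1 one_pCons)
next
  case (Suc j)
  then show ?case by (simp add: indet_q_def to_fract_def monom_Suc)
qed

lemma indet_q_not_root_of_unity:
  assumes "j > 0"
  shows "indet_q ^ j \<noteq> (1 :: 'k::field_char_0 poly poly fract)"
proof
  assume "indet_q ^ j = (1 :: 'k poly poly fract)"
  then have "to_fract [:monom 1 j:] = (to_fract 1 :: 'k poly poly fract)"
    by (simp add: indet_q_power)
  then have "monom 1 j = (1 :: 'k poly)"
    unfolding to_fract_eq_iff by (simp add: one_pCons)
  then show False
    using assms degree_monom_eq[of "1 :: 'k" j] by simp
qed

lemma indet_nonzero: "indet_q \<noteq> 0" "indet_s \<noteq> 0"
  by (simp_all add: indet_q_def indet_s_def Zero_fract_def eq_fract)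

theorem theorem5p10:
  fixes q s :: "'k::field_char_0 poly poly fract" and n :: nat
  assumes "q = indet_q" and "s = indet_s"
  shows "fps_of_poly (qcheb_T n s q) =
           fps_const (q ^ (n * (n + 1)) / (\<Prod>k = 1..n. qnum q (2 * k - 1)))
           * (1 / hsub q (- (1 / s)))
           * (qdiff q ^^ n)
               (hsub q (- (1 / (q ^ (2 * n) * s)))
                * (\<Prod>k = 1..n. fps_const (1 / q ^ (2 * k + 1)) * fps_X ^ 2 + fps_const (s / q)))
         \<and> fps_of_poly (qcheb_U n s q) =
           fps_const (q ^ (n * (n + 1)) * qnum q (n + 1) / (\<Prod>k = 1..n. qnum q (2 * k + 1)))
           * hsub q (- (q / s))
           * (qdiff q ^^ n)
               (1 / hsub q (- (1 / (q powi (2 * int n - 1) * s)))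
                * (\<Prod>k = 1..n. fps_const (1 / q ^ (2 * k - 1)) * fps_X ^ 2 + fps_const (s / q)))"
proof -
  have "q ^ j \<noteq> 1" if "j > 0" for j
    using indet_q_not_root_of_unity[OF that] by (simp add: assms(1))
  moreover have "q \<noteq> 0" "s \<noteq> 0"
    using indet_nonzero by (simp_all add: assms)
  ultimately show ?thesis
    using qcheb_T_rodrigues[of q s n] qcheb_U_rodrigues[of q s n] by blast
qed

end
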